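(* Let $p\in\mathbb{R}$ and let $p_1=\log_{\pi/2}2=\frac{\ln 2}{\ln(\pi/2)}=1.5349\ldots$. The inequality $$T(a,b)>A_p(a,b)$$ holds for all $a,b>0$ with $a\neq b$ if and only if $p\leq p_1$. Moreover, for all $a,b>0$ with $a\neq b$, $$\beta_1 A_{p_1}(a,b)<T(a,b)<\beta_2 A_{p_1}(a,b),$$ where $\beta_1=1$ and a constant $\beta_2$, whose value rounded to four decimal places is $1.0136$, are the best possible constants.
   Context: For $a,b>0$ with $a\neq b$, the second Seiffert mean is $$T(a,b)=\frac{a-b}{2\arctan\frac{a-b}{a+b}}.$$ The power mean of order $r\in\mathbb{R}$ is $A_r(a,b)=\left(\frac{a^r+b^r}{2}\right)^{1/r}$ if $r\neq 0$, and $A_0(a,b)=\sqrt{ab}$.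
   Formalization: The upper bound is proved as T ≤ β₂A_{p₁}, strict except when a/b or b/a equals one number x>1, since the best constant β₂ is attained there and strictness for all a≠b is impossible; β₂ is least among constants for which the strict bound always holds. *)

theory Defs
  imports Complex_Main
begin

text \<open>The second Seiffert mean, meant for distinct positive arguments.\<close>

definition seiffert_T :: "real \<Rightarrow> real \<Rightarrow> real" where
  "seiffert_T a b = (a - b) / (2 * arctan ((a - b) / (a + b)))"

definition power_mean :: "real \<Rightarrow> real \<Rightarrow> real \<Rightarrow> real" where
  "power_mean r a b =
     (if r = 0 then sqrt (a * b) else ((a powr r + b powr r) / 2) powr (1 / r))"

definition p\<^sub>1 :: real where
  "p\<^sub>1 = log (pi / 2) 2"

end

theory Submission
  imports Defs "HOL-Analysis.Harmonic_Numbers" "HOL-Analysis.Complex_Transcendental"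
begin

text \<open>
  Both means are symmetric and homogeneous, so only the ratio of the arguments matters. With
  \<open>a = g e^t\<close>, \<open>b = g e^-t\<close> they become \<open>T = g sinh t / arctan (tanh t)\<close> and
  \<open>A_p = g (cosh (p t))^(1/p)\<close>, and everything is read off the graph of
  \<open>f_p (t) = ln (sinh t / arctan (tanh t)) - ln (cosh (p t)) / p\<close> for \<open>t > 0\<close>.

  The function starts at \<open>f_p (0) = 0\<close> and has limit \<open>ln 2 / p - ln (pi / 2)\<close> at infinity
  (\<open>log_ratio_at_top\<close>). The exponent \<open>p\<^sub>1\<close> is exactly the one for which this limit vanishes. For
  larger \<open>p\<close> the limit is negative, so \<open>T > A_p\<close> fails; for smaller \<open>p\<close> the inequality follows
  from the case \<open>p\<^sub>1\<close>, because power means increase with the exponent (\<open>log_cosh_mean_mono\<close>).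

  For \<open>p = p\<^sub>1\<close> the function rises to a single maximum and then falls (\<open>log_ratio_shape\<close>). Being 0
  at both ends it is positive in between, which is the lower bound, and the vanishing limit makes
  the constant 1 optimal. The maximum, attained at one point \<open>m\<close> only, is the logarithm of the
  optimal upper constant. The shape comes from two differentiations that strip positive factors:
  the sign of \<open>f'\<close> is that of \<open>slope_factor\<close>, which vanishes at 0 and whose derivative has the
  sign of the combination \<open>sinh_comb\<close> of three hyperbolic sines. For exponents between 3/2 and 5/3
  that combination is strictly concave with positive slope at 0, so it changes sign once, from
  positive to negative, and this pattern is inherited by each antiderivative that starts at 0 and
  is negative somewhere (\<open>sign_change_antiderivative\<close>).

  The maximum is enclosed numerically (\<open>maximum_bounds\<close>) by evaluating \<open>f\<close> and \<open>f'\<close> at one point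
  slightly to the left of \<open>m\<close>: there \<open>f'\<close> is positive and it decreases up to \<open>m\<close>, so the tangent
  line bounds \<open>f (m)\<close> from above.
\<close>

section \<open>The two means in hyperbolic coordinates\<close>

text \<open>
  The logarithm of the power mean of \<open>e^t\<close> and \<open>e^-t\<close>. At \<open>p = 0\<close> the division by zero gives the
  value 0, which is right for the geometric mean.
\<close>

definition log_cosh_mean :: "real \<Rightarrow> real \<Rightarrow> real" where
  "log_cosh_mean p t = ln (cosh (p * t)) / p"

definition log_ratio :: "real \<Rightarrow> real \<Rightarrow> real" where
  "log_ratio p t = ln (sinh t / arctan (tanh t)) - log_cosh_mean p t"

lemma tanh_half_ln:
  fixes x :: real
  assumes "x > 0"
  shows "tanh (ln x / 2) = (x - 1) / (x + 1)"
  using tanh_ln_real[of "sqrt x"] assms by (simp add: ln_sqrt)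

lemma cosh_ln_powr:
  fixes x p :: real
  assumes "x > 0"
  shows "cosh (p * (ln x / 2)) = (x powr (p / 2) + x powr (- p / 2)) / 2"
  using assms by (simp add: cosh_def powr_def)

lemma power_mean_sym: "power_mean p b a = power_mean p a b"
  by (simp add: power_mean_def add.commute mult.commute)

lemma seiffert_T_sym: "seiffert_T b a = seiffert_T a b"
proof -
  have "(b - a) / (b + a) = - ((a - b) / (a + b))"
    by (metis add.commute minus_diff_eq minus_divide_left)
  then have "seiffert_T b a = (b - a) / (- (2 * arctan ((a - b) / (a + b))))"
    by (simp add: seiffert_T_def arctan_minus)
  also have "\<dots> = (- (b - a)) / (2 * arctan ((a - b) / (a + b)))"
    by (metis minus_divide_left minus_divide_right)
  finally show ?thesis
    by (simp add: seiffert_T_def)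
qed

lemma power_mean_eq:
  assumes "a > 0" "b > 0"
  shows "power_mean p a b = sqrt (a * b) * exp (log_cosh_mean p (ln (a / b) / 2))"
proof (cases "p = 0")
  case True
  then show ?thesis by (simp add: power_mean_def log_cosh_mean_def)
next
  case False
  have g: "(sqrt (a * b)) powr p = a powr (p/2) * b powr (p/2)"
    using assms by (simp add: powr_half_sqrt[symmetric] powr_powr powr_mult)
  have "cosh (p * (ln (a / b) / 2)) = ((a/b) powr (p / 2) + (a/b) powr (- p / 2)) / 2"
    using assms by (intro cosh_ln_powr) simp
  then have "(sqrt (a * b)) powr p * cosh (p * (ln (a / b) / 2)) = (a powr p + b powr p) / 2"
    using assms unfolding g
    by (simp add: powr_divide powr_minus field_simps flip: powr_add)
  then have "power_mean p a b = ((sqrt (a * b)) powr p * cosh (p * (ln (a / b) / 2))) powr (1/p)"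
    using False by (simp only: power_mean_def if_False)
  also have "\<dots> = sqrt (a * b) * cosh (p * (ln (a / b) / 2)) powr (1/p)"
    using assms False by (simp add: powr_mult powr_powr)
  also have "\<dots> = sqrt (a * b) * exp (log_cosh_mean p (ln (a / b) / 2))"
    by (simp add: powr_def log_cosh_mean_def)
  finally show ?thesis .
qed

lemma seiffert_T_eq:
  assumes "a > b" "b > 0"
  shows "seiffert_T a b = sqrt (a * b) * (sinh (ln (a / b) / 2) / arctan (tanh (ln (a / b) / 2)))"
proof -
  have t: "tanh (ln (a / b) / 2) = (a - b) / (a + b)"
  proof -
    have "(a / b - 1) / (a / b + 1) = (a - b) / (a + b)"
      using assms by (simp add: divide_simps add_pos_pos)
    then show ?thesis using tanh_half_ln[of "a/b"] assms by simp
  qed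
  have s: "sinh (ln (a / b) / 2) = (sqrt (a / b) - inverse (sqrt (a / b))) / 2"
    using sinh_ln_real[of "sqrt (a / b)"] assms by (simp add: ln_sqrt)
  have "sqrt (a * b) * sinh (ln (a / b) / 2) = (a - b) / 2"
    unfolding s using assms
    by (simp add: real_sqrt_divide real_sqrt_mult right_diff_distrib)
  then show ?thesis unfolding seiffert_T_def t
    by (metis (no_types, opaque_lifting) divide_divide_eq_left times_divide_eq_right)
qed

lemma seiffert_T_eq_power_mean:
  assumes "a > 0" "b > 0" "a \<noteq> b"
  shows "seiffert_T a b = exp (log_ratio p (\<bar>ln (a / b)\<bar> / 2)) * power_mean p a b"
    and "power_mean p a b > 0"
proof -
  have main: "seiffert_T a b = exp (log_ratio p (ln (a / b) / 2)) * power_mean p a b"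
    if "a > b" "b > 0" for a b :: real
  proof -
    let ?t = "ln (a / b) / 2"
    have "sinh ?t / arctan (tanh ?t) > 0"
      using that by (intro divide_pos_pos) auto
    then have "exp (log_ratio p ?t) = sinh ?t / arctan (tanh ?t) / exp (log_cosh_mean p ?t)"
      by (simp only: log_ratio_def exp_diff exp_ln)
    then show ?thesis
      using that by (simp add: seiffert_T_eq power_mean_eq)
  qed
  show "power_mean p a b > 0"
    using assms by (simp add: power_mean_eq)
  show "seiffert_T a b = exp (log_ratio p (\<bar>ln (a / b)\<bar> / 2)) * power_mean p a b"
  proof (cases "a > b")
    case True
    then show ?thesis using main[of b a] assms by simp
  next
    case False
    then have "b > a" using assms by simp
    moreover from this have "\<bar>ln (a / b)\<bar> = ln (b / a)"
      using assms by (simp add: ln_div)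
    ultimately show ?thesis
      using main[of a b] assms by (simp add: power_mean_sym seiffert_T_sym)
  qed
qed

text \<open>
  Convexity of \<open>x^r\<close> at the midpoint of \<open>e^t\<close> and \<open>e^-t\<close>; this is the power mean inequality for
  positive exponents.
\<close>

lemma cosh_powr_le:
  fixes r t :: real
  assumes "r \<ge> 1"
  shows "cosh t powr r \<le> cosh (r * t)"
proof -
  have "((1/2) * exp t + (1/2) * exp (-t)) powr r \<le> (1/2) * exp t powr r + (1/2) * exp (-t) powr r"
    using convex_onD[OF powr_convex[OF assms], of "1/2" "exp t" "exp (-t)"] by simp
  then show ?thesis
    by (simp add: cosh_def powr_def add_divide_distrib)
qed

lemma log_cosh_mean_mono:
  assumes "p \<le> q" "q > 0"
  shows "log_cosh_mean p t \<le> log_cosh_mean q t"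
proof (cases "p > 0")
  case True
  have "cosh (p * t) powr (q / p) \<le> cosh (q / p * (p * t))"
    using assms True by (intro cosh_powr_le) simp
  then have "ln (cosh (p * t) powr (q / p)) \<le> ln (cosh (q * t))"
    using True by (subst ln_le_cancel_iff) auto
  then show ?thesis
    using True assms by (simp add: log_cosh_mean_def ln_powr field_simps)
next
  case False
  have nonneg: "ln (cosh (r :: real)) \<ge> 0" for r
    by (simp add: cosh_real_ge_1)
  have "log_cosh_mean p t \<le> 0"
    using False nonneg[of "p * t"] by (simp add: log_cosh_mean_def divide_nonneg_nonpos)
  also have "0 \<le> log_cosh_mean q t"
    using assms nonneg[of "q * t"] by (simp add: log_cosh_mean_def)
  finally show ?thesis .
qed

section \<open>Functions that change sign once\<close>

definition sign_change_at :: "(real \<Rightarrow> real) \<Rightarrow> real \<Rightarrow> bool" where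
  "sign_change_at h z \<longleftrightarrow> z > 0 \<and> (\<forall>t. 0 < t \<and> t < z \<longrightarrow> h t > 0) \<and> (\<forall>t>z. h t < 0)"

lemma sign_change_bounds:
  assumes "sign_change_at h z" "t > 0"
  shows "h t < 0 \<Longrightarrow> z \<le> t" "h t > 0 \<Longrightarrow> t \<le> z"
  using assms unfolding sign_change_at_def by (meson less_asym not_le)+

lemma sign_change_decreasing:
  assumes "continuous_on {0..} F" "F 0 > 0" "s > 0" "F s < 0"
    and deriv: "\<And>t. t > 0 \<Longrightarrow> (F has_real_derivative D t) (at t)"
    and neg: "\<And>t. t > 0 \<Longrightarrow> D t < 0"
  shows "\<exists>z. sign_change_at F z"
proof -
  have dec: "F u > F v" if "0 \<le> u" "u < v" for u v
  proof (rule DERIV_neg_imp_decreasing_open[OF that(2)])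
    show "\<exists>y. (F has_real_derivative y) (at t) \<and> y < 0" if "u < t" "t < v" for t
      using deriv[of t] neg[of t] that \<open>0 \<le> u\<close> by force
    show "continuous_on {u..v} F"
      using assms(1) by (rule continuous_on_subset) (use that in auto)
  qed
  obtain z where z: "0 \<le> z" "z \<le> s" "F z = 0"
    using IVT2'[of F s 0 0] continuous_on_subset[OF assms(1), of "{0..s}"] assms by auto
  with assms have "z > 0" by (metis less_eq_real_def less_irrefl)
  with z dec show ?thesis unfolding sign_change_at_def by (metis less_eq_real_def)
qed

text \<open>
  The function increases as long as the sign of \<open>h\<close> is positive and decreases afterwards. Starting
  from 0 it is positive up to the sign change of \<open>h\<close>, hence it can become negative only on the
  decreasing branch, where it has exactly one zero. The weight \<open>w\<close> absorbs positive factors of the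
  derivative.
\<close>

lemma sign_change_antiderivative:
  assumes "continuous_on {0..} F" "F 0 = 0" "s > 0" "F s < 0"
    and deriv: "\<And>t. t > 0 \<Longrightarrow> (F has_real_derivative w t * h t) (at t)"
    and w: "\<And>t. t > 0 \<Longrightarrow> w t > 0"
    and h: "\<exists>z. sign_change_at h z"
  shows "\<exists>z. sign_change_at F z"
proof -
  obtain z where z: "z > 0" "\<And>t. 0 < t \<Longrightarrow> t < z \<Longrightarrow> h t > 0" "\<And>t. t > z \<Longrightarrow> h t < 0"
    using h unfolding sign_change_at_def by blast
  have cont: "continuous_on {u..v} F" if "0 \<le> u" for u v
    using assms(1) by (rule continuous_on_subset) (use that in auto)
  have pos: "F t > 0" if "0 < t" "t \<le> z" for t
  proof -
    have "F 0 < F t"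
    proof (rule DERIV_pos_imp_increasing_open[OF that(1)])
      show "\<exists>y. (F has_real_derivative y) (at u) \<and> 0 < y" if "0 < u" "u < t" for u
        using deriv[of u] mult_pos_pos[OF w[of u] z(2)[of u]] that \<open>t \<le> z\<close> by force
    qed (use cont in auto)
    with assms(2) show ?thesis by simp
  qed
  have dec: "F u > F v" if "z \<le> u" "u < v" for u v
  proof (rule DERIV_neg_imp_decreasing_open[OF that(2)])
    show "\<exists>y. (F has_real_derivative y) (at t) \<and> y < 0" if "u < t" "t < v" for t
      using deriv[of t] mult_pos_neg[OF w[of t] z(3)[of t]] that \<open>z \<le> u\<close> z(1) by force
  qed (use that z(1) cont in auto)
  have "s > z" using pos assms by (meson less_asym not_less)
  then obtain y where y: "z \<le> y" "y \<le> s" "F y = 0"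
    using IVT2'[of F s 0 z] assms(4) pos[of z] z cont by (auto simp: less_imp_le)
  with pos[of z] z have "z < y" by (metis less_eq_real_def less_irrefl)
  have "F t > 0" if "0 < t" "t < y" for t
    using pos[of t] dec[of t y] that y by force
  moreover have "F t < 0" if "t > y" for t
    using dec[of y t] that y by force
  ultimately show ?thesis
    unfolding sign_change_at_def using \<open>z < y\<close> z by (intro exI[of _ y]) auto
qed

section \<open>The sign of the derivative of the quotient\<close>

text \<open>
  Up to a factor that is positive for \<open>t > 0\<close>, this is the derivative of \<open>slope_factor\<close> below.
\<close>

definition sinh_comb :: "real \<Rightarrow> real \<Rightarrow> real" where
  "sinh_comb p t = (p + 1) * sinh t - (p - 1) * sinh (3 * t) - 2 * sinh ((2 * p - 3) * t)"

text \<open>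
  Up to a factor that is positive for \<open>t > 0\<close>, this is the derivative of \<open>log_ratio\<close>. Multiplying
  by \<open>arctan (tanh t)\<close> isolates the arctangent, so that one more differentiation removes it.
\<close>

definition slope_factor :: "real \<Rightarrow> real \<Rightarrow> real" where
  "slope_factor p t = arctan (tanh t) - sinh t * cosh (p * t) / (cosh (2 * t) * cosh ((p - 1) * t))"

lemma sinh_3: "sinh (3 * t) = 3 * sinh t + 4 * sinh t ^ 3" for t :: real
proof -
  have "sinh (3 * t) = sinh (2 * t + t)" by simp
  then show ?thesis
    by (simp only: sinh_add cosh_double sinh_double)
       (use cosh_square_eq[of t] in algebra)
qed

text \<open>
  At 0 the combination vanishes and has derivative \<open>10 - 6 p\<close>, which is positive exactly for
  \<open>p < 5/3\<close>. Its second derivative is negative for \<open>t > 0\<close>, since \<open>sinh (3 t) \<ge> 3 sinh t\<close>, so the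
  function is concave there.
\<close>

lemma sign_change_sinh_comb:
  assumes "3/2 \<le> p" "p < 5/3"
  shows "\<exists>z. sign_change_at (sinh_comb p) z"
proof -
  define q where "q = 2 * p - 3"
  define k' where "k' t = (p + 1) * cosh t - 3 * (p - 1) * cosh (3 * t) - 2 * q * cosh (q * t)" for t
  define k'' where "k'' t = (p + 1) * sinh t - 9 * (p - 1) * sinh (3 * t) - 2 * q\<^sup>2 * sinh (q * t)" for t
  have q: "0 \<le> q" using assms by (simp add: q_def)
  have dk: "(sinh_comb p has_real_derivative k' t) (at t)" for t
    unfolding sinh_comb_def k'_def q_def
    by (auto intro!: derivative_eq_intros simp: algebra_simps)
  have dk': "(k' has_real_derivative k'' t) (at t)" for t
    unfolding k'_def k''_def
    by (auto intro!: derivative_eq_intros simp: algebra_simps power2_eq_square)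
  have k''_neg: "k'' t < 0" if "t > 0" for t
  proof -
    have s: "sinh t > 0" using that by simp
    have "(p + 1) * sinh t < 9 * (p - 1) * (3 * sinh t)"
      using s assms by simp
    also have "\<dots> \<le> 9 * (p - 1) * sinh (3 * t)"
      using s assms by (intro mult_left_mono) (auto simp: sinh_3)
    finally show ?thesis
      using q that unfolding k''_def by (smt (verit) mult_nonneg_nonneg sinh_real_nonneg_iff zero_le_power2)
  qed
  \<comment> \<open>A point where the combination is already negative; \<open>sinh (3 s)\<close> is then a polynomial value.\<close>
  define s :: real where "s = arsinh 2"
  have s: "s > 0" "sinh s = 2" by (auto simp: s_def)
  have ks: "sinh_comb p s < 0"
  proof -
    have "sinh ((2 * p - 3) * s) \<ge> 0" using s q by (simp add: q_def)
    moreover have "(p + 1) * sinh s - (p - 1) * sinh (3 * s) < 0"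
      using s assms by (simp add: sinh_3)
    ultimately show ?thesis unfolding sinh_comb_def by linarith
  qed
  \<comment> \<open>The mean value theorem passes the negative sign on to the derivative.\<close>
  have "\<exists>u>0. u < s \<and> k' u < 0"
  proof -
    obtain u where u: "0 < u" "u < s" "sinh_comb p s - sinh_comb p 0 = (s - 0) * k' u"
      using MVT2[of 0 s "sinh_comb p" k'] s dk by blast
    then have "s * k' u < 0" using ks by (simp add: sinh_comb_def)
    with s u show ?thesis by (auto simp: mult_less_0_iff)
  qed
  then obtain u where u: "u > 0" "k' u < 0" by blast
  have "\<exists>z. sign_change_at k' z"
  proof (rule sign_change_decreasing[OF _ _ u dk' k''_neg])
    show "continuous_on {0..} k'"
      using dk' by (meson DERIV_isCont continuous_at_imp_continuous_on)
    show "k' 0 > 0" using assms by (simp add: k'_def q_def)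
  qed
  then show ?thesis
    by (intro sign_change_antiderivative[where F = "sinh_comb p" and s = s and w = "\<lambda>_. 1" and h = k'])
       (use dk s ks in \<open>auto simp: sinh_comb_def intro!: continuous_intros\<close>)
qed

text \<open>
  An explicit range on which \<open>slope_factor\<close> is therefore decreasing. The last hyperbolic sine only
  helps, and the other two are \<open>sinh t\<close> times a polynomial in \<open>(sinh t)^2\<close>.
\<close>

lemma sinh_comb_neg:
  assumes "3/2 \<le> p" "t > 0" "sinh t ^ 2 > 1/2"
  shows "sinh_comb p t < 0"
proof -
  have s: "sinh t > 0" using assms by simp
  have "sinh_comb p t \<le> (p + 1) * sinh t - (p - 1) * sinh (3 * t)"
    using assms by (simp add: sinh_comb_def)
  also have "\<dots> = sinh t * ((p + 1) - (p - 1) * (3 + 4 * sinh t ^ 2))"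
    unfolding sinh_3 by (simp add: algebra_simps power2_eq_square power3_eq_cube)
  also have "\<dots> < 0"
  proof -
    have "(p - 1) * 5 < (p - 1) * (3 + 4 * sinh t ^ 2)"
      using assms by (intro mult_strict_left_mono) auto
    then show ?thesis using s assms by (intro mult_pos_neg) auto
  qed
  finally show ?thesis .
qed

lemma arctan_tanh_deriv: "((\<lambda>t. arctan (tanh t)) has_real_derivative 1 / cosh (2 * t)) (at t)"
proof -
  define c s where "c = cosh t" and "s = sinh t"
  have cs: "c\<^sup>2 = 1 + s\<^sup>2" and pos: "c > 0"
    by (simp_all add: c_def s_def cosh_square_eq)
  have "tanh t ^ 2 = s\<^sup>2 / c\<^sup>2"
    by (simp add: tanh_def c_def s_def power_divide)
  moreover have "1 = c\<^sup>2 / c\<^sup>2"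
    using pos by simp
  moreover have "1 = c\<^sup>2 - s\<^sup>2"
    using cs by simp
  ultimately have "1 + tanh t ^ 2 = (c\<^sup>2 + s\<^sup>2) / c\<^sup>2" "1 - tanh t ^ 2 = 1 / c\<^sup>2"
    by (metis add_divide_distrib, metis diff_divide_distrib)
  then have "(1 - tanh t ^ 2) / (1 + tanh t ^ 2) = 1 / cosh (2 * t)"
    using pos by (simp add: cosh_double c_def s_def)
  moreover have "((\<lambda>t. arctan (tanh t)) has_real_derivative
      (1 - tanh t ^ 2) / (1 + tanh t ^ 2)) (at t)"
    by (auto intro!: derivative_eq_intros simp: divide_inverse)
  ultimately show ?thesis by simp
qed

text \<open>
  By the addition theorems all terms are polynomials in the hyperbolic functions of \<open>t\<close> and
  \<open>(p - 1) t\<close>, so the identity is algebraic modulo \<open>cosh^2 = 1 + sinh^2\<close> for both arguments.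
\<close>

lemma slope_factor_deriv:
  "(slope_factor p has_real_derivative
     sinh t / (2 * (cosh (2 * t) * cosh ((p - 1) * t))\<^sup>2) * sinh_comb p t) (at t)"
proof -
  define c s C S where "c = cosh t" and "s = sinh t" and "C = cosh ((p-1)*t)" and "S = sinh ((p-1)*t)"
  have cs: "c^2 = 1 + s^2" "C^2 = 1 + S^2"
    by (simp_all add: c_def s_def C_def S_def cosh_square_eq)
  have "p * t = (p-1)*t + t" by (simp add: algebra_simps)
  then have p: "cosh (p * t) = C * c + S * s" "sinh (p * t) = S * c + C * s"
    by (simp_all only: cosh_add sinh_add c_def s_def C_def S_def)
  have d: "cosh (2*t) = c^2 + s^2" "sinh (2*t) = 2 * s * c"
    by (simp_all add: cosh_double sinh_double c_def s_def)
  have "(2 * p - 3) * t = 2 * ((p-1) * t) - t" by (simp add: algebra_simps)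
  then have q: "sinh ((2 * p - 3) * t) = 2 * S * C * c - (C^2 + S^2) * s"
    by (simp only: sinh_diff cosh_double sinh_double c_def s_def C_def S_def)
  \<comment> \<open>The quotient rule, with \<open>N\<close> the numerator and \<open>E\<close> the denominator of the fraction in \<open>slope_factor\<close>.\<close>
  define E where "E = cosh (2 * t) * C"
  define N where "N = s * cosh (p * t)"
  define N' where "N' = c * cosh (p * t) + s * (p * sinh (p * t))"
  define E' where "E' = 2 * sinh (2 * t) * C + cosh (2 * t) * ((p - 1) * S)"
  have E: "E > 0" and C: "C > 0" by (simp_all add: E_def C_def)
  have "((\<lambda>t. sinh t * cosh (p * t)) has_real_derivative N') (at t)"
    unfolding N'_def c_def s_def by (auto intro!: derivative_eq_intros simp: algebra_simps)
  moreover have "((\<lambda>t. cosh (2 * t) * cosh ((p - 1) * t)) has_real_derivative E') (at t)"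
    unfolding E'_def C_def S_def by (auto intro!: derivative_eq_intros simp: algebra_simps)
  ultimately have "(slope_factor p has_real_derivative
      1 / cosh (2 * t) - (N' * E - N * E') / (E * E)) (at t)"
    using E unfolding slope_factor_def
    by (intro DERIV_diff arctan_tanh_deriv)
       (auto intro!: DERIV_divide simp: E_def N_def C_def s_def)
  moreover have "1 / cosh (2 * t) - (N' * E - N * E') / (E * E) = s / (2 * E\<^sup>2) * sinh_comb p t"
  proof -
    have key: "2 * (E * C - (N' * E - N * E')) = s * sinh_comb p t"
      unfolding sinh_comb_def sinh_3 q p d s_def[symmetric] E_def N_def N'_def E'_def
      using cs by algebra
    have "1 / cosh (2 * t) = E * C / (E * E)"
      using E C by (simp add: E_def)
    then have "1 / cosh (2 * t) - (N' * E - N * E') / (E * E) = (E * C - (N' * E - N * E')) / E\<^sup>2"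
      by (simp only: diff_divide_distrib power2_eq_square)
    also have "\<dots> = 2 * (E * C - (N' * E - N * E')) / (2 * E\<^sup>2)"
      by (rule mult_divide_mult_cancel_left[symmetric]) simp
    finally show ?thesis unfolding key by simp
  qed
  ultimately show ?thesis by (simp add: C_def s_def E_def)
qed

definition log_ratio_slope :: "real \<Rightarrow> real \<Rightarrow> real" where
  "log_ratio_slope p t = cosh t / sinh t - tanh (p * t) - 1 / (cosh (2 * t) * arctan (tanh t))"

lemma log_ratio_deriv:
  assumes "t > 0" "p \<noteq> 0"
  shows "(log_ratio p has_real_derivative log_ratio_slope p t) (at t)"
proof -
  have th: "arctan (tanh t) > 0" using assms by simp
  have "((\<lambda>t. ln (sinh t) - ln (arctan (tanh t)) - ln (cosh (p * t)) / p)
          has_real_derivative log_ratio_slope p t) (at t)"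
  proof -
    have "((\<lambda>t. ln (sinh t)) has_real_derivative cosh t / sinh t) (at t)"
      using assms by (auto intro!: derivative_eq_intros)
    moreover have "((\<lambda>t. ln (arctan (tanh t))) has_real_derivative
        1 / (cosh (2 * t) * arctan (tanh t))) (at t)"
      using DERIV_chain2[OF DERIV_ln_divide[OF th] arctan_tanh_deriv] by (simp add: mult.commute)
    moreover have "((\<lambda>t. ln (cosh (p * t)) / p) has_real_derivative tanh (p * t)) (at t)"
      using assms by (auto intro!: derivative_eq_intros simp: tanh_def)
    ultimately have "((\<lambda>t. ln (sinh t) - ln (arctan (tanh t)) - ln (cosh (p * t)) / p) has_real_derivative
        cosh t / sinh t - 1 / (cosh (2 * t) * arctan (tanh t)) - tanh (p * t)) (at t)"
      by (intro DERIV_diff)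
    then show ?thesis
      by (simp add: log_ratio_slope_def algebra_simps)
  qed
  then show ?thesis
  proof (rule has_field_derivative_transform_within_open[of _ _ _ "{0<..}"])
    show "ln (sinh u) - ln (arctan (tanh u)) - ln (cosh (p * u)) / p = log_ratio p u"
      if "u \<in> {0<..}" for u
      using that by (simp add: log_ratio_def log_cosh_mean_def ln_div)
  qed (use assms in auto)
qed

lemma coth_minus_tanh:
  fixes t p :: real
  assumes "t > 0"
  shows "cosh t / sinh t - tanh (p * t) = cosh ((p - 1) * t) / (sinh t * cosh (p * t))"
proof -
  have e: "(p - 1) * t = p * t - t" by (simp add: algebra_simps)
  show ?thesis
    unfolding e cosh_diff tanh_def using assms by (simp add: divide_simps)
qed

text \<open>
  The fraction subtracted in \<open>slope_factor\<close> is the quotient of \<open>1 / cosh (2 t)\<close> and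
  \<open>coth t - tanh (p t)\<close>, so factoring out the latter difference leaves \<open>slope_factor\<close>.
\<close>

lemma log_ratio_slope_eq:
  assumes "t > 0"
  shows "log_ratio_slope p t = (cosh t / sinh t - tanh (p * t)) / arctan (tanh t) * slope_factor p t"
proof -
  have th: "arctan (tanh t) > 0" using assms by simp
  have "1 / cosh (2 * t) = (cosh t / sinh t - tanh (p * t)) *
      (sinh t * cosh (p * t) / (cosh (2 * t) * cosh ((p - 1) * t)))"
    using assms by (simp add: coth_minus_tanh)
  then have "1 / (cosh (2 * t) * arctan (tanh t)) = (cosh t / sinh t - tanh (p * t)) *
      (sinh t * cosh (p * t) / (cosh (2 * t) * cosh ((p - 1) * t))) / arctan (tanh t)"
    by (metis divide_divide_eq_left)
  moreover have "w - w * x / th = w / th * (th - x)" if "th > 0" for w x th :: real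
    using that by (simp add: field_simps)
  ultimately show ?thesis
    using th by (simp only: log_ratio_slope_def slope_factor_def)
qed

lemma log_ratio_slope_sign:
  assumes "t > 0"
  shows "log_ratio_slope p t > 0 \<longleftrightarrow> slope_factor p t > 0" "log_ratio_slope p t < 0 \<longleftrightarrow> slope_factor p t < 0"
proof -
  have "cosh t / sinh t - tanh (p * t) > 0" "arctan (tanh t) > 0"
    using assms by (simp_all add: coth_minus_tanh)
  then show "log_ratio_slope p t > 0 \<longleftrightarrow> slope_factor p t > 0" "log_ratio_slope p t < 0 \<longleftrightarrow> slope_factor p t < 0"
    unfolding log_ratio_slope_eq[OF assms]
    by (simp_all add: zero_less_mult_iff mult_less_0_iff zero_less_divide_iff divide_less_0_iff)
qed

section \<open>Limits of the quotient at zero and infinity\<close>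

lemma log_ratio_0 [simp]: "log_ratio p 0 = 0"
  by (simp add: log_ratio_def log_cosh_mean_def)

text \<open>
  The value at 0 comes from the convention \<open>0 / 0 = 0\<close> and \<open>ln 0 = 0\<close>, and it is also the limit at
  0, because \<open>sinh t\<close> and \<open>arctan (tanh t)\<close> are both asymptotic to \<open>t\<close>.
\<close>

lemma isCont_log_ratio_0:
  assumes "p \<noteq> 0"
  shows "isCont (log_ratio p) 0"
proof -
  have "(\<lambda>h. sinh h / h) \<midarrow>0\<rightarrow> (1::real)"
    using DERIV_D[of sinh "1::real" 0] by (force intro!: derivative_eq_intros)
  moreover have "(\<lambda>h. arctan (tanh h) / h) \<midarrow>0\<rightarrow> (1::real)"
    using DERIV_D[OF arctan_tanh_deriv[of 0]] by simp
  ultimately have "(\<lambda>h. (sinh h / h) / (arctan (tanh h) / h)) \<midarrow>0\<rightarrow> (1::real) / 1"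
    by (intro tendsto_divide) auto
  moreover have "\<forall>\<^sub>F h in at 0. (sinh h / h) / (arctan (tanh h) / h) = sinh h / arctan (tanh (h::real))"
    by (auto simp: eventually_at_filter)
  ultimately have "(\<lambda>h. sinh h / arctan (tanh h)) \<midarrow>0\<rightarrow> (1::real)"
    by (auto intro: Lim_transform_eventually)
  then have "(\<lambda>h. ln (sinh h / arctan (tanh h))) \<midarrow>0\<rightarrow> ln (1::real)"
    by (intro tendsto_ln) auto
  moreover have "log_cosh_mean p \<midarrow>0\<rightarrow> log_cosh_mean p 0"
    unfolding log_cosh_mean_def using assms by (intro tendsto_intros) auto
  ultimately have "(\<lambda>h. ln (sinh h / arctan (tanh h)) - log_cosh_mean p h)
      \<midarrow>0\<rightarrow> ln 1 - log_cosh_mean p 0"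
    by (rule tendsto_diff)
  then show ?thesis
    by (simp add: isCont_def log_ratio_def[abs_def] log_cosh_mean_def)
qed

text \<open>
  Splitting off the factor \<open>e^t\<close> from \<open>sinh t\<close> and from \<open>(cosh (p t))^(1/p)\<close> makes the linear
  terms cancel and leaves convergent expressions.
\<close>

lemma log_ratio_at_top:
  assumes "p > 0"
  shows "(log_ratio p \<longlongrightarrow> ln 2 / p - ln (pi / 2)) at_top"
proof -
  have e: "((\<lambda>t. exp (- (c * t))) \<longlongrightarrow> 0) at_top" if "c > 0" for c :: real
    using that by (auto intro!: filterlim_compose[OF exp_at_bot] 
        filterlim_tendsto_pos_mult_at_top[OF tendsto_const] filterlim_ident
        simp: filterlim_uminus_at_bot)
  have th: "((\<lambda>t::real. arctan (tanh t)) \<longlongrightarrow> pi / 4) at_top"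
    using tendsto_arctan[OF tanh_real_at_top] by (simp add: arctan_one)
  have "((\<lambda>t. ln ((1 - exp (- (2 * t))) / (2 * arctan (tanh t))) - ln ((1 + exp (- (2 * p * t))) / 2) / p)
      \<longlongrightarrow> ln ((1 - 0) / (2 * (pi / 4))) - ln ((1 + 0) / 2) / p) at_top"
    using assms by (intro tendsto_intros e th) auto
  moreover have "ln ((1 - 0) / (2 * (pi / 4))) - ln ((1 + 0) / 2) / p = ln 2 / p - ln (pi / 2)"
    by (simp add: ln_div)
  moreover have "\<forall>\<^sub>F t in at_top. ln ((1 - exp (- (2 * t))) / (2 * arctan (tanh t)))
      - ln ((1 + exp (- (2 * p * t))) / 2) / p = log_ratio p t"
    using eventually_gt_at_top[of 0]
  proof eventually_elim
    case (elim t)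
    have "sinh t = exp t * ((1 - exp (- (2 * t))) / 2)"
      by (simp add: sinh_def right_diff_distrib flip: exp_add)
    then have "sinh t / arctan (tanh t) = exp t * ((1 - exp (- (2 * t))) / (2 * arctan (tanh t)))"
      by (metis divide_divide_eq_left times_divide_eq_right)
    moreover have "(1 - exp (- (2 * t))) / (2 * arctan (tanh t)) > 0" using elim by simp
    ultimately have "ln (sinh t / arctan (tanh t)) = t + ln ((1 - exp (- (2 * t))) / (2 * arctan (tanh t)))"
      by (simp only: ln_mult_pos exp_gt_zero ln_exp)
    moreover have "cosh (p * t) = exp (p * t) * ((1 + exp (- (2 * p * t))) / 2)"
      by (simp add: cosh_def distrib_left flip: exp_add)
    moreover have "(1 + exp (- (2 * p * t))) / 2 > 0" by (simp add: add_pos_pos)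
    ultimately show ?case
      using assms by (simp add: log_ratio_def log_cosh_mean_def ln_mult_pos add_divide_distrib)
  qed
  ultimately show ?thesis by (auto intro: Lim_transform_eventually)
qed

section \<open>The shape of the quotient\<close>

lemma arctan_bounds:
  fixes y :: real
  assumes "y \<ge> 0"
  shows "y - y^3/3 + y^5/5 - y^7/7 \<le> arctan y" (is "?l y \<le> _")
    and "arctan y \<le> y - y^3/3 + y^5/5 - y^7/7 + y^9/9" (is "_ \<le> ?u y")
proof -
  have "arctan 0 - ?l 0 \<le> arctan y - ?l y"
  proof (rule DERIV_nonneg_imp_nondecreasing[OF assms])
    fix x :: real
    have "1 - x^2 + x^4 - x^6 \<le> 1 / (1 + x^2)"
    proof -
      have "(1 - x^2 + x^4 - x^6) * (1 + x^2) = 1 - (x^4)^2" by algebra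
      then have "(1 - x^2 + x^4 - x^6) * (1 + x^2) \<le> 1" by (smt (verit) zero_le_power2)
      then show ?thesis by (simp add: pos_le_divide_eq add_pos_nonneg)
    qed
    moreover have "((\<lambda>x. arctan x - ?l x) has_real_derivative 1 / (1 + x^2) - (1 - x^2 + x^4 - x^6)) (at x)"
      by (auto intro!: derivative_eq_intros simp: field_simps)
    ultimately show "\<exists>d. ((\<lambda>x. arctan x - ?l x) has_real_derivative d) (at x) \<and> 0 \<le> d" by auto
  qed
  then show "?l y \<le> arctan y" by simp
  have "?u 0 - arctan 0 \<le> ?u y - arctan y"
  proof (rule DERIV_nonneg_imp_nondecreasing[OF assms])
    fix x :: real
    have "1 / (1 + x^2) \<le> 1 - x^2 + x^4 - x^6 + x^8"
    proof -
      have "(1 - x^2 + x^4 - x^6 + x^8) * (1 + x^2) = 1 + (x^5)^2" by algebra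
      then have "(1 - x^2 + x^4 - x^6 + x^8) * (1 + x^2) \<ge> 1" by (smt (verit) zero_le_power2)
      then show ?thesis by (simp add: pos_divide_le_eq add_pos_nonneg)
    qed
    moreover have "((\<lambda>x. ?u x - arctan x) has_real_derivative (1 - x^2 + x^4 - x^6 + x^8) - 1 / (1 + x^2)) (at x)"
      by (auto intro!: derivative_eq_intros simp: field_simps)
    ultimately show "\<exists>d. ((\<lambda>x. ?u x - arctan x) has_real_derivative d) (at x) \<and> 0 \<le> d" by auto
  qed
  then show "arctan y \<le> ?u y" by simp
qed

text \<open>
  Near 1 the argument of the arctangent is too large for a short Taylor polynomial; passing to the
  complementary angle replaces it by \<open>1 / x\<close>.
\<close>

lemma arctan_complement:
  fixes x :: real
  assumes "x > 1"
  shows "arctan ((x - 1) / (x + 1)) = pi / 4 - arctan (1 / x)"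
proof -
  have "arctan (1 / x) + arctan ((x - 1) / (x + 1)) = arctan ((1 / x + (x - 1) / (x + 1)) / (1 - 1 / x * ((x - 1) / (x + 1))))"
    using assms by (intro arctan_add) (auto simp: abs_if divide_simps)
  also have "(1 / x + (x - 1) / (x + 1)) / (1 - 1 / x * ((x - 1) / (x + 1))) = 1"
  proof -
    have "1 / x + (x - 1) / (x + 1) = (x^2 + 1) / (x * (x + 1))"
      "1 - 1 / x * ((x - 1) / (x + 1)) = (x^2 + 1) / (x * (x + 1))"
      using assms by (simp_all add: divide_simps) (simp_all add: algebra_simps power2_eq_square)
    moreover have "x^2 + 1 > 0" by (simp add: add_nonneg_pos)
    ultimately show ?thesis using assms by simp
  qed
  finally show ?thesis by (simp add: arctan_one)
qed

text \<open>
  The point \<open>ln (11/4)\<close> is chosen so that one estimate serves all \<open>p \<ge> 3/2\<close> and still lies close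
  enough to the maximum for the numerical bounds below. The fraction in \<open>slope_factor\<close> increases
  with \<open>p\<close>, since it depends on \<open>p\<close> only through \<open>tanh ((p - 1) t)\<close>; at \<open>p = 3/2\<close> its value is
  about 0.6555, against about 0.6539 for the arctangent.
\<close>

lemma slope_factor_neg:
  assumes "p \<ge> 3/2"
  shows "slope_factor p (ln (11 / 4)) < 0"
proof -
  define t :: real where "t = ln (11 / 4)"
  have t: "t > 0" by (simp add: t_def)
  have c: "cosh t = 137 / 88" and s: "sinh t = 105 / 88"
    by (simp_all add: t_def cosh_ln_real sinh_ln_real)
  have "arctan (tanh t) = arctan ((121/16 - 1) / (121/16 + 1))"
    by (simp add: tanh_def c s)
  also have "\<dots> = pi / 4 - arctan (16 / 121)"
    by (subst arctan_complement) simp_all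
  also have "\<dots> < 654 / 1000"
    using arctan_bounds(1)[of "16/121"] pi_approx by (simp add: power_numeral_reduce)
  finally have th: "arctan (tanh t) < 654 / 1000" .
  have half: "tanh (t / 2) = 7 / 15"
    using tanh_half_ln[of "11/4"] by (simp add: t_def)
  have "t / 2 \<le> (p - 1) * t" using t assms by simp
  then have "tanh ((p - 1) * t) \<ge> 7 / 15"
    using half by (metis tanh_real_le_iff)
  then have T: "105 / 88 * (137 / 88 + 105 / 88 * tanh ((p - 1) * t)) \<ge> 105 / 88 * (137 / 88 + 105 / 88 * (7 / 15))"
    by simp
  have "p * t = (p - 1) * t + t" by (simp add: algebra_simps)
  then have "sinh t * cosh (p * t) / (cosh (2 * t) * cosh ((p - 1) * t))
      = sinh t * (cosh t + sinh t * tanh ((p - 1) * t)) / cosh (2 * t)"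
  proof -
    assume e: "p * t = (p - 1) * t + t"
    show ?thesis unfolding e by (simp add: cosh_add tanh_def add_divide_distrib distrib_left distrib_right mult_ac)
  qed
  also have "\<dots> = 105 / 88 * (137 / 88 + 105 / 88 * tanh ((p - 1) * t)) / ((137 / 88)\<^sup>2 + (105 / 88)\<^sup>2)"
    by (simp only: cosh_double c s)
  also have "\<dots> \<ge> 105 / 88 * (137 / 88 + 105 / 88 * (7 / 15)) / ((137 / 88)\<^sup>2 + (105 / 88)\<^sup>2)"
    using T by (rule divide_right_mono) simp
  finally have "sinh t * cosh (p * t) / (cosh (2 * t) * cosh ((p - 1) * t)) \<ge> 655 / 1000"
    by (simp add: power2_eq_square)
  with th show ?thesis by (simp add: slope_factor_def t_def)
qed

lemma sign_change_slope_factor: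
  assumes "3/2 \<le> p" "p < 5/3"
  shows "\<exists>z. sign_change_at (slope_factor p) z"
proof (rule sign_change_antiderivative)
  show "continuous_on {0..} (slope_factor p)"
    using slope_factor_deriv by (meson DERIV_isCont continuous_at_imp_continuous_on)
  show "(slope_factor p has_real_derivative sinh t / (2 * (cosh (2 * t) * cosh ((p - 1) * t))\<^sup>2) * sinh_comb p t) (at t)" for t
    by (rule slope_factor_deriv)
  show "0 < sinh t / (2 * (cosh (2 * t) * cosh ((p - 1) * t))\<^sup>2)" if "t > 0" for t
    using that by (intro divide_pos_pos mult_pos_pos zero_less_power) auto
  show "slope_factor p (ln (11/4)) < 0" by (rule slope_factor_neg[OF assms(1)])
  show "\<exists>z. sign_change_at (sinh_comb p) z" by (rule sign_change_sinh_comb[OF assms])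
qed (auto simp: slope_factor_def)

lemma log_ratio_slope_sign_change:
  assumes "3/2 \<le> p" "p < 5/3"
  obtains m where "sign_change_at (log_ratio_slope p) m" "m \<le> ln (11 / 4)"
proof -
  obtain m where m: "sign_change_at (slope_factor p) m"
    using sign_change_slope_factor[OF assms] by blast
  moreover have "m \<le> ln (11 / 4)"
    using sign_change_bounds(1)[OF m _ slope_factor_neg[OF assms(1)]] by simp
  moreover have "sign_change_at (log_ratio_slope p) m"
    using m by (auto simp: sign_change_at_def log_ratio_slope_sign)
  ultimately show thesis using that by blast
qed

text \<open>
  Before \<open>m\<close> the values increase from 0, and after \<open>m\<close> they decrease to the limit at infinity;
  hence they stay above the smaller of these two end values.
\<close>

lemma log_ratio_shape:
  assumes "p > 0" and m: "sign_change_at (log_ratio_slope p) m"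
  shows log_ratio_less_peak: "t > 0 \<Longrightarrow> t \<noteq> m \<Longrightarrow> log_ratio p t < log_ratio p m"
    and log_ratio_lower: "t > 0 \<Longrightarrow> log_ratio p t > min 0 (ln 2 / p - ln (pi / 2))"
proof -
  note m = m[unfolded sign_change_at_def]
  have deriv: "(log_ratio p has_real_derivative log_ratio_slope p t) (at t)" if "t > 0" for t
    using log_ratio_deriv[OF that] assms(1) by simp
  have "isCont (log_ratio p) t" if "t \<ge> 0" for t
    using isCont_log_ratio_0[of p] DERIV_isCont[OF deriv[of t]] assms(1) that by (cases "t = 0") auto
  then have cont: "continuous_on {u..v} (log_ratio p)" if "u \<ge> 0" for u v
    using that by (auto intro: continuous_at_imp_continuous_on)
  have inc: "log_ratio p u < log_ratio p v" if "0 \<le> u" "u < v" "v \<le> m" for u v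
  proof (rule DERIV_pos_imp_increasing_open[OF that(2)])
    show "\<exists>y. (log_ratio p has_real_derivative y) (at t) \<and> 0 < y" if "u < t" "t < v" for t
      using deriv[of t] m that \<open>0 \<le> u\<close> \<open>v \<le> m\<close> by force
  qed (use that cont in auto)
  have dec: "log_ratio p u > log_ratio p v" if "m \<le> u" "u < v" for u v
  proof (rule DERIV_neg_imp_decreasing_open[OF that(2)])
    show "\<exists>y. (log_ratio p has_real_derivative y) (at t) \<and> y < 0" if "u < t" "t < v" for t
      using deriv[of t] m that \<open>m \<le> u\<close> by force
  qed (use that m cont in auto)
  show "log_ratio p t < log_ratio p m" if "t > 0" "t \<noteq> m"
    using inc[of t m] dec[of m t] that by fastforce
  show "log_ratio p t > min 0 (ln 2 / p - ln (pi / 2))" if "t > 0"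
  proof (cases "t \<le> m")
    case True
    then show ?thesis using inc[of 0 t] that by simp
  next
    case False
    have "ln 2 / p - ln (pi / 2) < log_ratio p t"
    proof (rule DERIV_neg_imp_decreasing_at_top[where f = "log_ratio p" and b = t])
      show "\<exists>y. (log_ratio p has_real_derivative y) (at u) \<and> y < 0" if "t \<le> u" for u
        using deriv[of u] m that False by force
    qed (rule log_ratio_at_top[OF assms(1)])
    then show ?thesis by simp
  qed
qed

section \<open>Numerical bounds\<close>

text \<open>
  Splitting off powers of 2 brings all arguments of logarithms into the interval from 1 to 2,
  where the series below converges quickly.
\<close>

lemma ln_power_2_mult: "x > 0 \<Longrightarrow> ln (2 ^ n * x) = ln x + real n * ln 2" for x :: real
  by (simp add: ln_mult_pos ln_realpow)

text \<open>
  Six terms of the series \<open>ln ((1 + y) / (1 - y)) = 2 (y + y^3/3 + y^5/5 + ...)\<close>, with the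
  remainder dominated by a geometric series. The Horner form keeps the numerals short when the
  bounds are evaluated at decimal \<open>y\<close>, and the inequality between \<open>x\<close> and \<open>(1 + y) / (1 - y)\<close>
  allows \<open>y\<close> to be a rounded value of \<open>(x - 1) / (x + 1)\<close>.
\<close>

lemma ln_bounds_rational:
  fixes x y :: real
  assumes y: "0 < y" "y < 1"
  shows ln_ge_rational: "(1 + y) / (1 - y) \<le> x \<Longrightarrow>
      l \<le> 2 * (y * (1 + y*y * (1/3 + y*y * (1/5 + y*y * (1/7 + y*y * (1/9 + y*y / 11)))))) \<Longrightarrow> l \<le> ln x"
    and ln_le_rational: "0 < x \<Longrightarrow> x \<le> (1 + y) / (1 - y) \<Longrightarrow>
      2 * (y * (1 + y*y * (1/3 + y*y * (1/5 + y*y * (1/7 + y*y * (1/9 + y*y * (1/11 + y*y / (13 * (1 - y*y)))))))) ) \<le> l \<Longrightarrow> ln x \<le> l"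
proof -
  let ?x = "(1 + y) / (1 - y)"
  define s where "s = y + y^3/3 + y^5/5 + y^7/7 + y^9/9 + y^11/11"
  have x: "?x > 1" using y by (simp add: field_simps)
  have q: "(?x - 1) / (?x + 1) = y" using y by (simp add: field_simps)
  have sum6: "(\<Sum>k<6. f k) = f 0 + f 1 + f 2 + f 3 + f 4 + f 5" for f :: "nat \<Rightarrow> real"
    by (simp add: eval_nat_numeral)
  have sum: "(\<Sum>k<6. 2 * y ^ (2*k+1) / of_nat (2*k+1)) = 2 * s"
    unfolding sum6 s_def by simp
  have b: "2 * s \<le> ln ?x" "ln ?x \<le> 2 * (s + y^13 / (1 - y\<^sup>2) / 13)"
    using ln_approx_bounds[OF x, of 6] unfolding q sum by simp_all
  have h: "s = y * (1 + y*y * (1/3 + y*y * (1/5 + y*y * (1/7 + y*y * (1/9 + y*y / 11)))))"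
    by (simp add: s_def algebra_simps power_numeral_reduce)
  have "y * (1 + y*y * (1/3 + y*y * (1/5 + y*y * (1/7 + y*y * (1/9 + y*y * (1/11 + w))))))
      = s + y^11 * w" for w
    unfolding h by (simp add: algebra_simps power_numeral_reduce)
  from this[of "y*y / (13 * (1 - y*y))"]
  have h': "y * (1 + y*y * (1/3 + y*y * (1/5 + y*y * (1/7 + y*y * (1/9 + y*y * (1/11 + y*y / (13 * (1 - y*y))))))))
      = s + y^13 / (1 - y\<^sup>2) / 13"
    by (simp add: power_numeral_reduce power2_eq_square mult.assoc)
  show "l \<le> ln x" if "?x \<le> x"
    "l \<le> 2 * (y * (1 + y*y * (1/3 + y*y * (1/5 + y*y * (1/7 + y*y * (1/9 + y*y / 11))))))"
  proof -
    have "l \<le> ln ?x" using b(1) that(2) unfolding h by linarith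
    also have "\<dots> \<le> ln x" using that x by (subst ln_le_cancel_iff) simp_all
    finally show ?thesis .
  qed
  show "ln x \<le> l" if "0 < x" "x \<le> ?x"
    "2 * (y * (1 + y*y * (1/3 + y*y * (1/5 + y*y * (1/7 + y*y * (1/9 + y*y * (1/11 + y*y / (13 * (1 - y*y)))))))) ) \<le> l"
  proof -
    have "ln x \<le> ln ?x" using that x by (subst ln_le_cancel_iff) simp_all
    also have "\<dots> \<le> l" using b(2) that(3) unfolding h' by linarith
    finally show ?thesis .
  qed
qed

lemma ln2_bounds: "0.69314718 \<le> ln (2::real)" "ln (2::real) \<le> 0.693147181"
  using ln_approx_bounds[of 2 9] by (simp_all add: eval_nat_numeral)

lemma ln_half_pi_bounds: "0.4515826 \<le> ln (pi / 2)" "ln (pi / 2) \<le> 0.4515828"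
proof -
  have "0.4515826 \<le> ln (1.5707963::real)"
    by (rule ln_ge_rational[of "0.22203093"]) simp_all
  also have "\<dots> \<le> ln (pi / 2)"
    using pi_approx by (subst ln_le_cancel_iff) auto
  finally show "0.4515826 \<le> ln (pi / 2)" .
  have "ln (pi / 2) \<le> ln (1.5707964::real)"
    using pi_approx by (subst ln_le_cancel_iff) auto
  also have "\<dots> \<le> 0.4515828"
    by (rule ln_le_rational[of "0.22203097"]) simp_all
  finally show "ln (pi / 2) \<le> 0.4515828" .
qed

lemma p1_eq: "p\<^sub>1 = ln 2 / ln (pi / 2)"
  by (simp add: p\<^sub>1_def log_def)

lemma p1_bounds: "1.534928 \<le> p\<^sub>1" "p\<^sub>1 \<le> 1.534929"
proof -
  have "ln (pi / 2) > 0" by (rule less_le_trans[OF _ ln_half_pi_bounds(1)]) simp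
  then show "1.534928 \<le> p\<^sub>1" "p\<^sub>1 \<le> 1.534929"
    unfolding p1_eq using ln2_bounds ln_half_pi_bounds
    by (simp_all only: pos_le_divide_eq pos_divide_le_eq) simp_all
qed

lemma ln_21_4: "1.6582280 \<le> ln (21/4 :: real)" "ln (21/4 :: real) \<le> 1.6582282"
proof -
  have "ln (21/4::real) = ln (21/16) + 2 * ln 2"
    using ln_power_2_mult[of "21/16" 2] by simp
  moreover have "0.2719337 \<le> ln (21/16::real)" "ln (21/16::real) \<le> 0.2719338"
    by (rule ln_ge_rational[of "5/37"] ln_le_rational[of "5/37"]; simp)+
  ultimately show "1.6582280 \<le> ln (21/4 :: real)" "ln (21/4 :: real) \<le> 1.6582282"
    using ln2_bounds by simp_all
qed

lemma arctan_17_25: "0.597176656 \<le> arctan (17/25::real)" "arctan (17/25::real) \<le> 0.5971767"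
proof -
  have eq: "arctan (17/25) = pi / 4 - arctan (4/21)"
    using arctan_complement[of "21/4"] by simp
  have "0.188221467 \<le> arctan (4/21::real)"
    by (rule order_trans[OF _ arctan_bounds(1)]) (simp_all add: power_numeral_reduce)
  moreover have "arctan (4/21::real) \<le> 0.188221507"
    by (rule order_trans[OF arctan_bounds(2)]) (simp_all add: power_numeral_reduce)
  ultimately show "0.597176656 \<le> arctan (17/25::real)" "arctan (17/25::real) \<le> 0.5971767"
    unfolding eq using pi_approx by simp_all
qed

lemma powr_p1_bounds: "12.74654 \<le> (21/4) powr p\<^sub>1" "(21/4) powr p\<^sub>1 \<le> 12.74658"
proof -
  have "ln (12.74654::real) = ln 1.5933175 + 3 * ln 2"
    using ln_power_2_mult[of "1.5933175" 3] by simp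
  also have "\<dots> \<le> 1.534928 * 1.6582280"
  proof -
    have "ln (1.5933175::real) \<le> 0.46581834"
      by (rule ln_le_rational[of "0.22878707"]) simp_all
    then show ?thesis using ln2_bounds by simp
  qed
  also have "\<dots> \<le> p\<^sub>1 * ln (21/4)"
    using p1_bounds ln_21_4 by (intro mult_mono) auto
  also have "\<dots> = ln ((21/4) powr p\<^sub>1)"
    by (simp add: ln_powr)
  finally show "12.74654 \<le> (21/4) powr p\<^sub>1"
    by (subst (asm) ln_le_cancel_iff) auto
  have "ln ((21/4) powr p\<^sub>1) = p\<^sub>1 * ln (21/4)"
    by (simp add: ln_powr)
  also have "\<dots> \<le> 1.534929 * 1.6582282"
    using p1_bounds ln_21_4 by (intro mult_mono) auto
  also have "\<dots> \<le> ln 1.5933225 + 3 * ln 2"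
  proof -
    have "0.46582145 \<le> ln (1.5933225::real)"
      by (rule ln_ge_rational[of "0.22878855"]) simp_all
    then show ?thesis using ln2_bounds by simp
  qed
  also have "\<dots> = ln (12.74658::real)"
    using ln_power_2_mult[of "1.5933225" 3] by simp
  finally show "(21/4) powr p\<^sub>1 \<le> 12.74658"
    by (subst (asm) ln_le_cancel_iff) auto
qed

text \<open>
  In terms of \<open>x = e^(2 t)\<close> the common summand \<open>t\<close> of both logarithms cancels, and only \<open>x powr p\<close>
  is left to be estimated.
\<close>

lemma log_ratio_half_ln:
  assumes "x > 1" "p \<noteq> 0"
  shows "log_ratio p (ln x / 2) =
    ln ((x - 1) / 2 / arctan ((x - 1) / (x + 1))) - ln ((x powr p + 1) / 2) / p"
proof -
  let ?t = "ln x / 2"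
  have th: "arctan ((x - 1) / (x + 1)) > 0" using assms by simp
  have "sinh ?t = exp (- ?t) * ((x - 1) / 2)"
    using assms by (simp add: sinh_def right_diff_distrib exp_minus) (simp add: field_simps flip: exp_add)
  then have "ln (sinh ?t / arctan (tanh ?t)) = ln (exp (- ?t) * ((x - 1) / 2 / arctan ((x - 1) / (x + 1))))"
    using assms by (simp only: tanh_half_ln times_divide_eq_right)
  also have "\<dots> = - ?t + ln ((x - 1) / 2 / arctan ((x - 1) / (x + 1)))"
    using assms th by (subst ln_mult_pos) auto
  finally have 1: "ln (sinh ?t / arctan (tanh ?t)) = - ?t + ln ((x - 1) / 2 / arctan ((x - 1) / (x + 1)))" .
  have "cosh (p * ?t) = exp (- (p * ?t)) * ((x powr p + 1) / 2)"
    using assms by (simp add: cosh_def powr_def distrib_left add.commute flip: exp_add)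
  then have "ln (cosh (p * ?t)) = - (p * ?t) + ln ((x powr p + 1) / 2)"
    by (simp only: ln_mult_pos[OF exp_gt_zero] ln_exp add_nonneg_pos powr_ge_zero half_gt_zero zero_less_one)
  then have "log_cosh_mean p ?t = - ?t + ln ((x powr p + 1) / 2) / p"
    using assms by (simp add: log_cosh_mean_def add_divide_distrib diff_divide_distrib)
  with 1 show ?thesis by (simp add: log_ratio_def)
qed

text \<open>
  The maximum is located near \<open>e^(2 t) = 5.3496\<close>. The point \<open>e^(2 t) = 21/4\<close> lies just to its
  left, and there \<open>log_ratio\<close> is about 0.0134631, only slightly below its maximum and above
  \<open>ln 1.01355\<close>, which is about 0.0134590.
\<close>

lemma log_ratio_21_4: 
  "log_ratio p\<^sub>1 (ln (21/4) / 2) \<ge> 0.01346"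
  "log_ratio p\<^sub>1 (ln (21/4) / 2) \<le> 0.013465"
proof -
  define y where "y = (21/4) powr p\<^sub>1"
  have y: "12.74654 \<le> y" "y \<le> 12.74658" using powr_p1_bounds by (simp_all add: y_def)
  have eq: "log_ratio p\<^sub>1 (ln (21/4) / 2) = ln (17 / 8 / arctan (17/25)) - ln ((y + 1) / 2) / p\<^sub>1"
    using log_ratio_half_ln[of "21/4" "p\<^sub>1"] p1_bounds by (simp add: y_def)
  have th: "arctan (17/25::real) > 0" by simp
  have 1: "1.2693137 \<le> ln (17 / 8 / arctan (17/25::real))"
  proof -
    have "1.2693137 \<le> ln (1.779205::real) + ln 2"
    proof -
      have "0.5761666 \<le> ln (1.779205::real)"
        by (rule ln_ge_rational[of "0.28036974"]) simp_all
      then show ?thesis using ln2_bounds by simp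
    qed
    also have "\<dots> = ln 3.55841"
      using ln_power_2_mult[of "1.779205" 1] by simp
    also have "\<dots> \<le> ln (17 / 8 / arctan (17/25))"
      using arctan_17_25 th by (subst ln_le_cancel_iff) (auto simp: pos_le_divide_eq)
    finally show ?thesis .
  qed
  have 2: "ln (17 / 8 / arctan (17/25::real)) \<le> 1.2693144"
  proof -
    have "ln (17 / 8 / arctan (17/25)) \<le> ln (3.558412::real)"
      using arctan_17_25 th by (subst ln_le_cancel_iff) (auto simp: pos_divide_le_eq)
    also have "\<dots> = ln 1.779206 + ln 2"
      using ln_power_2_mult[of "1.779206" 1] by simp
    also have "\<dots> \<le> 1.2693144"
    proof -
      have "ln (1.779206::real) \<le> 0.57616721"
        by (rule ln_le_rational[of "0.28037001"]) simp_all
      then show ?thesis using ln2_bounds by simp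
    qed
    finally show ?thesis .
  qed
  have 3: "1.9276399 \<le> ln ((y + 1) / 2)"
  proof -
    have "1.9276399 \<le> ln (1.7183175::real) + 2 * ln 2"
    proof -
      have "0.5413456 \<le> ln (1.7183175::real)"
        by (rule ln_ge_rational[of "0.26425077"]) simp_all
      then show ?thesis using ln2_bounds by simp
    qed
    also have "\<dots> = ln 6.87327"
      using ln_power_2_mult[of "1.7183175" 2] by simp
    also have "\<dots> \<le> ln ((y + 1) / 2)"
      using y by (subst ln_le_cancel_iff) auto
    finally show ?thesis .
  qed
  have 4: "ln ((y + 1) / 2) \<le> 1.92764291"
  proof -
    have "ln ((y + 1) / 2) \<le> ln 6.87329"
      using y by (subst ln_le_cancel_iff) auto
    also have "\<dots> = ln 1.7183225 + 2 * ln 2"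
      using ln_power_2_mult[of "1.7183225" 2] by simp
    also have "\<dots> \<le> 1.92764291"
    proof -
      have "ln (1.7183225::real) \<le> 0.54134854"
        by (rule ln_le_rational[of "0.26425213"]) simp_all
      then show ?thesis using ln2_bounds by simp
    qed
    finally show ?thesis .
  qed
  have "ln ((y + 1) / 2) / p\<^sub>1 \<le> 1.92764291 / 1.534928"
    using 3 4 p1_bounds by (intro frac_le) auto
  then show "log_ratio p\<^sub>1 (ln (21/4) / 2) \<ge> 0.01346"
    unfolding eq using 1 by simp
  have "1.9276399 / 1.534929 \<le> ln ((y + 1) / 2) / p\<^sub>1"
    using 3 p1_bounds by (intro frac_le) auto
  then show "log_ratio p\<^sub>1 (ln (21/4) / 2) \<le> 0.013465"
    unfolding eq using 2 by simp
qed

lemma log_ratio_slope_21_4: "log_ratio_slope p\<^sub>1 (ln (21/4) / 2) > 0" "log_ratio_slope p\<^sub>1 (ln (21/4) / 2) \<le> 0.000492"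
proof -
  define y where "y = (21/4) powr p\<^sub>1"
  have y: "12.74654 \<le> y" "y \<le> 12.74658" using powr_p1_bounds by (simp_all add: y_def)
  let ?t = "ln (21/4) / 2 :: real"
  have th: "tanh ?t = 17 / 25" using tanh_half_ln[of "21/4"] by simp
  have "p\<^sub>1 * ?t = ln y / 2" by (simp add: y_def ln_powr)
  then have "tanh (p\<^sub>1 * ?t) = (y - 1) / (y + 1)" using y tanh_half_ln[of y] by simp
  moreover have "cosh (2 * ?t) = 457 / 168" by (simp add: cosh_ln_real)
  moreover have "cosh ?t / sinh ?t = 25 / 17" using arg_cong[OF th, of inverse] by (simp add: tanh_def)
  ultimately have eq: "log_ratio_slope p\<^sub>1 ?t = 25 / 17 - (y - 1) / (y + 1) - 1 / (457 / 168 * arctan (17 / 25))"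
    by (simp only: log_ratio_slope_def th)
  define z where "z = 1 / (457 / 168 * arctan (17 / 25))"
  have "1 / (457 / 168 * 0.5971767) \<le> z" "z \<le> 1 / (457 / 168 * (0.597176656 :: real))"
    unfolding z_def using arctan_17_25 by (intro divide_left_mono mult_left_mono mult_pos_pos; simp)+
  then have z: "6155881 / 10000000 \<le> z" "z \<le> 6155882 / 10000000"
    by simp_all
  have w: "8545088 / 10000000 \<le> (y - 1) / (y + 1)" "(y - 1) / (y + 1) \<le> 8545093 / 10000000"
    using y by (simp_all add: divide_simps)
  show "log_ratio_slope p\<^sub>1 ?t > 0" unfolding eq z_def[symmetric] using z w by linarith
  have "log_ratio_slope p\<^sub>1 ?t \<le> 492 / 1000000" unfolding eq z_def[symmetric] using z w by linarith
  then show "log_ratio_slope p\<^sub>1 ?t \<le> 0.000492" by simp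
qed

text \<open>
  Between \<open>t\<close> and the maximum the derivative is a product of two nonnegative decreasing functions,
  by \<open>log_ratio_slope_eq\<close>.
\<close>

lemma log_ratio_slope_antimono:
  assumes "p \<ge> 3/2" "0 < t" "t < u" "sinh t ^ 2 > 1/2" "log_ratio_slope p u \<ge> 0"
  shows "log_ratio_slope p u \<le> log_ratio_slope p t"
proof -
  define w where "w t = cosh t / sinh t - tanh (p * t)" for t
  have "w u \<le> w t"
  proof -
    have "tanh t \<le> tanh u" "tanh (p * t) \<le> tanh (p * u)" "tanh t > 0"
      using assms by simp_all
    then have "1 / tanh u \<le> 1 / tanh t" "tanh (p * t) \<le> tanh (p * u)"
      by (auto intro: frac_le)
    then show ?thesis by (simp add: w_def tanh_def)
  qed
  moreover have "w u \<ge> 0" using assms by (simp add: w_def coth_minus_tanh)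
  ultimately have "w u / arctan (tanh u) \<le> w t / arctan (tanh t)"
    using assms by (intro frac_le arctan_monotone') auto
  moreover have "slope_factor p u \<ge> 0"
    using log_ratio_slope_sign(2)[of u p] assms by force
  moreover have "slope_factor p u \<le> slope_factor p t"
  proof (rule DERIV_nonpos_imp_nonincreasing[where f = "slope_factor p"])
    show "\<exists>y. (slope_factor p has_real_derivative y) (at v) \<and> y \<le> 0" if "t \<le> v" "v \<le> u" for v
    proof -
      have "sinh t ^ 2 \<le> sinh v ^ 2" using assms that by (intro power_mono) auto
      with assms(4) have "sinh v ^ 2 > 1/2" by (rule less_le_trans)
      then have "sinh_comb p v < 0" using assms that by (intro sinh_comb_neg) auto
      moreover have "sinh v > 0" using assms that by simp
      ultimately have "sinh v / (2 * (cosh (2 * v) * cosh ((p - 1) * v))\<^sup>2) * sinh_comb p v \<le> 0"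
        by (intro mult_nonneg_nonpos divide_nonneg_nonneg) auto
      with slope_factor_deriv[of p v] show ?thesis by blast
    qed
  qed (use assms in simp)
  moreover have "w t / arctan (tanh t) \<ge> 0" using assms by (simp add: w_def coth_minus_tanh)
  ultimately show ?thesis
    using assms unfolding w_def by (simp only: log_ratio_slope_eq mult_mono)
qed

text \<open>
  The upper bound is the tangent estimate: by the mean value theorem
  \<open>f (m) - f (t) \<le> (m - t) f' (t)\<close> for a point \<open>t\<close> to the left of \<open>m\<close>, because \<open>f'\<close> decreases from
  \<open>t\<close> to \<open>m\<close>.
\<close>

lemma maximum_bounds:
  assumes "m \<le> ln (11/4)" and m: "sign_change_at (log_ratio_slope p\<^sub>1) m"
  shows "0.01346 \<le> log_ratio p\<^sub>1 m" "log_ratio p\<^sub>1 m \<le> 0.013555"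
proof -
  define t where "t = ln (21/4 :: real) / 2"
  have t: "t > 0" by (simp add: t_def)
  show "0.01346 \<le> log_ratio p\<^sub>1 m"
    using log_ratio_21_4(1) log_ratio_less_peak[OF _ m t] p1_bounds unfolding t_def by force
  have up: "log_ratio_slope p\<^sub>1 u > 0" if "0 < u" "u < m" for u
    using m that by (simp add: sign_change_at_def)
  have "t \<le> m" using sign_change_bounds(2)[OF m t] log_ratio_slope_21_4(1) by (simp add: t_def)
  have s: "sinh t ^ 2 > 1/2"
  proof -
    have "cosh (2 * t) = 457 / 168" by (simp add: t_def cosh_ln_real)
    then show ?thesis by (simp add: cosh_double cosh_square_eq)
  qed
  show "log_ratio p\<^sub>1 m \<le> 0.013555"
  proof (cases "t = m")
    case True
    then show ?thesis using log_ratio_21_4(2) by (simp add: t_def)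
  next
    case False
    with \<open>t \<le> m\<close> have "t < m" by simp
    then obtain u where u: "t < u" "u < m" "log_ratio p\<^sub>1 m - log_ratio p\<^sub>1 t = (m - t) * log_ratio_slope p\<^sub>1 u"
      using MVT2[of t m "log_ratio p\<^sub>1" "log_ratio_slope p\<^sub>1"] log_ratio_deriv t p1_bounds by force
    have "log_ratio_slope p\<^sub>1 u \<le> log_ratio_slope p\<^sub>1 t"
      using u t up[of u] p1_bounds s by (intro log_ratio_slope_antimono) auto
    also have "\<dots> \<le> 0.000492" using log_ratio_slope_21_4(2) by (simp add: t_def)
    finally have "log_ratio_slope p\<^sub>1 u \<le> 0.000492" .
    moreover have "m - t \<le> 0.1825"
    proof -
      have "ln (121/84 :: real) = ln ((11/4)^2 / (21/4))" by (simp add: power2_eq_square)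
      also have "\<dots> = 2 * ln (11/4) - ln (21/4)" by (subst ln_divide_pos) (simp_all add: ln_realpow)
      finally have "2 * ln (11/4) - ln (21/4) = ln (121/84 :: real)" by simp
      moreover have "ln (121/84 :: real) \<le> 0.365"
        by (rule ln_le_rational[of "0.1805"]) simp_all
      ultimately show ?thesis using assms(1) by (simp add: t_def)
    qed
    ultimately have "(m - t) * log_ratio_slope p\<^sub>1 u \<le> 0.1825 * 0.000492"
      using \<open>t < m\<close> up[of u] u t by (intro mult_mono) auto
    then show ?thesis using u(3) log_ratio_21_4(2) by (simp add: t_def)
  qed
qed

section \<open>The optimal exponent and the optimal constants\<close>

lemma log_ratio_limit_p1: "ln 2 / p\<^sub>1 - ln (pi / 2) = 0"
proof -
  have "ln (pi / 2) > 0" by (rule less_le_trans[OF _ ln_half_pi_bounds(1)]) simp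
  then show ?thesis by (simp add: p1_eq)
qed

lemma seiffert_T_exp:
  assumes "t > 0"
  shows "seiffert_T (exp (2 * t)) 1 = exp (log_ratio p t) * power_mean p (exp (2 * t)) 1"
    and "power_mean p (exp (2 * t)) 1 > 0"
  using seiffert_T_eq_power_mean[of "exp (2 * t)" 1 p] assms by simp_all

lemma limit_nonneg_imp_le_p1:
  assumes "p > 0" "\<And>t. t > 0 \<Longrightarrow> log_ratio p t \<ge> 0"
  shows "p \<le> p\<^sub>1"
proof -
  have "ln 2 / p - ln (pi / 2) \<ge> 0"
    using assms(2)
    by (intro tendsto_lowerbound[OF log_ratio_at_top[OF assms(1)]] eventually_at_top_linorderI[of 1]) auto
  moreover have "ln (pi / 2) > 0" by (rule less_le_trans[OF _ ln_half_pi_bounds(1)]) simp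
  ultimately show ?thesis using assms(1) by (simp add: p1_eq field_simps)
qed

theorem theorem1p2:
  shows "p\<^sub>1 = ln 2 / ln (pi / 2) \<and> \<lfloor>10 ^ 4 * p\<^sub>1\<rfloor> = 15349 \<and>
    (\<forall>p::real. (\<forall>a>0. \<forall>b>0. a \<noteq> b \<longrightarrow> seiffert_T a b > power_mean p a b) \<longleftrightarrow> p \<le> p\<^sub>1) \<and>
    (\<forall>a>0. \<forall>b>0. a \<noteq> b \<longrightarrow> 1 * power_mean p\<^sub>1 a b < seiffert_T a b) \<and>
    (\<forall>\<beta>. (\<forall>a>0. \<forall>b>0. a \<noteq> b \<longrightarrow> \<beta> * power_mean p\<^sub>1 a b < seiffert_T a b) \<longrightarrow> \<beta> \<le> 1) \<and>
    (\<exists>\<beta>\<^sub>2::real. round (10 ^ 4 * \<beta>\<^sub>2) = 10136 \<and>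
      (\<forall>a>0. \<forall>b>0. a \<noteq> b \<longrightarrow> seiffert_T a b \<le> \<beta>\<^sub>2 * power_mean p\<^sub>1 a b) \<and>
      (\<exists>x>1. \<forall>a>0. \<forall>b>0. a \<noteq> b \<longrightarrow> a \<noteq> x * b \<longrightarrow> b \<noteq> x * a \<longrightarrow>
         seiffert_T a b < \<beta>\<^sub>2 * power_mean p\<^sub>1 a b) \<and>
      (\<forall>\<beta>. (\<forall>a>0. \<forall>b>0. a \<noteq> b \<longrightarrow> seiffert_T a b < \<beta> * power_mean p\<^sub>1 a b) \<longrightarrow> \<beta>\<^sub>2 \<le> \<beta>))"
proof -
  have p1: "3/2 \<le> p\<^sub>1" "p\<^sub>1 < 5/3" using p1_bounds by simp_all
  obtain m where m: "sign_change_at (log_ratio_slope p\<^sub>1) m" "m \<le> ln (11 / 4)"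
    using log_ratio_slope_sign_change[OF p1] .
  have m_pos: "m > 0" using m(1) by (simp add: sign_change_at_def)
  have max: "log_ratio p\<^sub>1 t < log_ratio p\<^sub>1 m" if "t > 0" "t \<noteq> m" for t
    using log_ratio_less_peak[OF _ m(1) that] p1 by simp
  have pos: "log_ratio p\<^sub>1 t > 0" if "t > 0" for t
    using log_ratio_lower[OF _ m(1) that] p1 by (simp add: log_ratio_limit_p1)
  define t where "t a b = \<bar>ln (a / b)\<bar> / 2" for a b :: real
  have t: "t a b > 0" if "a > 0" "b > 0" "a \<noteq> b" for a b
    using that by (simp add: t_def ln_div)
  note ratio = seiffert_T_eq_power_mean[folded t_def]

  have strict: "power_mean p a b < seiffert_T a b" if "a > 0" "b > 0" "a \<noteq> b" "p \<le> p\<^sub>1" for p a b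
  proof -
    have "log_ratio p (t a b) > 0"
      using pos[OF t[OF that(1-3)]] log_cosh_mean_mono[OF that(4), of "t a b"] p1
      by (simp add: log_ratio_def)
    then show ?thesis using ratio[OF that(1-3), of p] by simp
  qed
  have conv: "p \<le> p\<^sub>1" if "\<forall>a>0. \<forall>b>0. a \<noteq> b \<longrightarrow> seiffert_T a b > power_mean p a b" for p
  proof (cases "p > 0")
    case True
    show ?thesis
    proof (rule limit_nonneg_imp_le_p1[OF True])
      fix u :: real assume u: "u > 0"
      have "power_mean p (exp (2 * u)) 1 < seiffert_T (exp (2 * u)) 1"
        using that u by simp
      then show "log_ratio p u \<ge> 0"
        using seiffert_T_exp[OF u, of p] by simp
    qed
  qed (use p1 in simp)
  have sharp1: "\<beta> \<le> 1" if "\<forall>a>0. \<forall>b>0. a \<noteq> b \<longrightarrow> \<beta> * power_mean p\<^sub>1 a b < seiffert_T a b" for \<beta>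
  proof -
    have "\<beta> \<le> exp (log_ratio p\<^sub>1 u)" if u: "u > 0" for u
    proof -
      have "\<beta> * power_mean p\<^sub>1 (exp (2 * u)) 1 < seiffert_T (exp (2 * u)) 1"
        using \<open>\<forall>a>0. _ a\<close> u by simp
      then show ?thesis using seiffert_T_exp[OF u, of "p\<^sub>1"] by simp
    qed
    then have "\<beta> \<le> exp (ln 2 / p\<^sub>1 - ln (pi / 2))"
      by (intro tendsto_lowerbound[OF tendsto_exp[OF log_ratio_at_top]]
            eventually_at_top_linorderI[of 1]) (use p1 in auto)
    then show ?thesis by (simp add: log_ratio_limit_p1)
  qed

  define \<beta>\<^sub>2 where "\<beta>\<^sub>2 = exp (log_ratio p\<^sub>1 m)"
  have \<beta>\<^sub>2: "1.01355 < \<beta>\<^sub>2" "\<beta>\<^sub>2 < 1.01365"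
  proof -
    have "ln 1.01355 < log_ratio p\<^sub>1 m"
    proof -
      have "ln 1.01355 \<le> (0.01345903 :: real)"
        by (rule ln_le_rational[of "0.00672941"]) simp_all
      then show ?thesis using maximum_bounds(1)[OF m(2,1)] by simp
    qed
    then show "1.01355 < \<beta>\<^sub>2" unfolding \<beta>\<^sub>2_def by (subst (asm) exp_less_cancel_iff[symmetric]) simp
    have "log_ratio p\<^sub>1 m < ln 1.01365"
    proof -
      have "0.01355766 \<le> ln (1.01365 :: real)"
        by (rule ln_ge_rational[of "0.00677873"]) simp_all
      then show ?thesis using maximum_bounds(2)[OF m(2,1)] by simp
    qed
    then show "\<beta>\<^sub>2 < 1.01365" unfolding \<beta>\<^sub>2_def by (subst (asm) exp_less_cancel_iff[symmetric]) simp
  qed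
  have upper_strict: "seiffert_T a b < \<beta>\<^sub>2 * power_mean p\<^sub>1 a b"
    if "a > 0" "b > 0" "a \<noteq> b" "t a b \<noteq> m" for a b
    using max[of "t a b"] t[OF that(1-3)] that(4) ratio[OF that(1-3), of "p\<^sub>1"]
    by (simp add: \<beta>\<^sub>2_def)
  have upper: "seiffert_T a b \<le> \<beta>\<^sub>2 * power_mean p\<^sub>1 a b" if "a > 0" "b > 0" "a \<noteq> b" for a b
    using upper_strict[OF that] ratio(1)[OF that, of "p\<^sub>1"] by (cases "t a b = m") (auto simp: \<beta>\<^sub>2_def)
  have off_peak: "t a b \<noteq> m"
    if "a > 0" "b > 0" "a \<noteq> b" "a \<noteq> exp (2 * m) * b" "b \<noteq> exp (2 * m) * a" for a b
  proof
    assume "t a b = m"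
    then have "ln (a / b) = 2 * m \<or> ln (b / a) = 2 * m"
      using that(1,2) by (auto simp: t_def ln_div abs_if split: if_splits)
    then have "a / b = exp (2 * m) \<or> b / a = exp (2 * m)"
      using that(1,2) by (metis divide_pos_pos exp_ln)
    then show False using that by (auto simp: field_simps)
  qed
  have sharp2: "\<beta>\<^sub>2 \<le> \<beta>" if "\<forall>a>0. \<forall>b>0. a \<noteq> b \<longrightarrow> seiffert_T a b < \<beta> * power_mean p\<^sub>1 a b" for \<beta>
  proof -
    have "seiffert_T (exp (2 * m)) 1 < \<beta> * power_mean p\<^sub>1 (exp (2 * m)) 1"
      using that m_pos by simp
    then show ?thesis using seiffert_T_exp[OF m_pos, of "p\<^sub>1"] by (simp add: \<beta>\<^sub>2_def)
  qed
  have floor: "\<lfloor>10 ^ 4 * p\<^sub>1\<rfloor> = 15349"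
    using p1_bounds by (simp add: floor_eq_iff)
  have round: "round (10 ^ 4 * \<beta>\<^sub>2) = 10136"
    using \<beta>\<^sub>2 by (simp add: round_def floor_eq_iff)
  show ?thesis
    using p1_eq floor round strict conv sharp1 sharp2 upper upper_strict off_peak m_pos
    by (intro conjI exI[of _ "\<beta>\<^sub>2"] exI[of _ "exp (2 * m)"]) auto
qed

end
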